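(* Let $L_E\subset\mathbb{O}$ be the Coxeter--Dickson order, equipped with the three products $x\cdot y$ (octonionic), $x\bullet y=\overline{x}\cdot\overline{y}$ (para-octonionic) and $x*y=\tau(\overline{x})\cdot\tau^{2}(\overline{y})$ (Okubo), each giving a $\mathbb{Z}$-integral system on $L_E$ with its composition norm. Then the identity map on $L_E$ is an isometry among the three integral systems. In particular, all three systems have the same Gram matrix, the same $240$ roots (elements of norm one), and the same Gosset polytope $4_{21}$ (whose vertices are these roots). The three systems $(L_E,\cdot)$, $(L_E,\bullet)$, $(L_E,* )$ are pairwise non-isomorphic as algebras.
   Context: Octonions: $\mathbb{O}$ is the real algebra with basis $e_0=1,e_1,\dots,e_7$, where $1$ is the unit, $e_k^2=-1$ for $k\ge 1$, $e_ie_j=-e_je_i$ for distinct $i,j\geq 1$, and $e_ie_j=e_k$ whenever $(i,j,k)$ is a cyclic permutation of one of the seven oriented triples $(1,2,4),(1,3,7),(2,3,6),(4,3,5),(6,1,5),(5,2,7),(7,4,6)$. Conjugation is $\overline{x_0+\sum_{k\ge1} x_ke_k}=x_0-\sum_{k\ge1} x_ke_k$, the norm is $n(x)=\sum_{k=0}^7x_k^2=x\overline{x}$, and $\langle x,y\rangle=x\overline{y}+y\overline{x}$, so $\langle x,x\rangle=2n(x)$. The norm $n$ is the composition norm for all three products. The automorphism $\tau$ of $\mathbb{O}$ is the linear map with $\tau(1)=1$, $\tau(e_3)=e_3$, $\tau(e_1)=e_2$, $\tau(e_2)=-e_4$, $\tau(e_4)=-e_1$, $\tau(e_5)=-e_7$,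 $\tau(e_7)=e_6$, $\tau(e_6)=-e_5$. $L_E$ is the $\mathbb{Z}$-span of $1,e_1,e_2,e_3,h,e_1h,e_2h,e_3h$ with $h=\frac{e_1+e_2+e_3+e_4}{2}$; the Gram matrix is taken with respect to $\langle\cdot,\cdot\rangle$. Integral systems: let $A$ be an eight-dimensional real composition algebra with product $\circ$, norm $n$, and a chosen nonzero idempotent $e$ (here $e=1$). A $\mathbb{Z}$-integral system relative to $e$ is a free $\mathbb{Z}$-module $L\subset A$ of rank eight such that: (1) $e\in L$ and $L$ is closed under $\circ$; (2) $n(x)\in\mathbb{Z}$ and $\operatorname{tr}_e(x)=\langle x,e\rangle\in\mathbb{Z}$ for every $x\in L$; (3) $L$ is a discrete Euclidean lattice for the bilinear form associated with $n$. The Gosset polytope $4_{21}$ is the 8-dimensional uniform polytope whose 240 vertices are the roots of the $E_8$ root system. *)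

theory Defs
  imports "HOL-Analysis.Analysis"
begin

section \<open>Octonions\<close>

text \<open>The coordinates are indexed by the type \<open>8\<close>, the integers modulo 8, so the indices are
  \<open>0, 1, \<dots>, 7\<close> and \<open>ee i\<close> is the unit \<open>e\<^sub>i\<close>. The squared length \<open>oct_norm\<close> is not the library's \<open>norm\<close>.\<close>

type_synonym octonion = "real ^ 8"

definition ee :: "8 \<Rightarrow> octonion" where
  "ee i = axis i 1"

definition oriented_triples :: "(8 \<times> 8 \<times> 8) set" where
  "oriented_triples =
     {(1,2,4), (1,3,7), (2,3,6), (4,3,5), (6,1,5), (5,2,7), (7,4,6)}"

definition cyclic_triple :: "8 \<Rightarrow> 8 \<Rightarrow> 8 \<Rightarrow> bool" where
  "cyclic_triple i j k \<longleftrightarrow>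
     (i,j,k) \<in> oriented_triples \<or> (j,k,i) \<in> oriented_triples \<or> (k,i,j) \<in> oriented_triples"

text \<open>For distinct nonzero \<open>i\<close>, \<open>j\<close> there is exactly one \<open>k\<close> such that \<open>(i,j,k)\<close> or \<open>(j,i,k)\<close>
  is a cyclic permutation of an oriented triple, so exactly one of the two sums below is nonempty,
  and it has a single term.\<close>

definition unit_mult :: "8 \<Rightarrow> 8 \<Rightarrow> octonion" where
  "unit_mult i j =
     (if i = 0 then ee j
      else if j = 0 then ee i
      else if i = j then - ee 0
      else (\<Sum>k | cyclic_triple i j k. ee k) - (\<Sum>k | cyclic_triple j i k. ee k))"

definition oct_mult :: "octonion \<Rightarrow> octonion \<Rightarrow> octonion"  (infixl "\<odot>" 70) where
  "x \<odot> y = (\<Sum>i\<in>UNIV. \<Sum>j\<in>UNIV. (x $ i * y $ j) *\<^sub>R unit_mult i j)"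

definition oct_conj :: "octonion \<Rightarrow> octonion" where
  "oct_conj x = (\<chi> k. if k = 0 then x $ 0 else - x $ k)"

definition oct_norm :: "octonion \<Rightarrow> real" where
  "oct_norm x = (\<Sum>k\<in>UNIV. (x $ k)\<^sup>2)"

text \<open>The octonion \<open>x \<odot> oct_conj y + y \<odot> oct_conj x\<close> is a real multiple of the unit \<open>ee 0\<close>;
  \<open>oct_form x y\<close> is that real number (see \<open>oct_form_eq\<close> below).\<close>

definition oct_form :: "octonion \<Rightarrow> octonion \<Rightarrow> real" where
  "oct_form x y = (x \<odot> oct_conj y + y \<odot> oct_conj x) $ 0"

definition tau :: "octonion \<Rightarrow> octonion" where
  "tau x = x $ 0 *\<^sub>R ee 0 + x $ 3 *\<^sub>R ee 3 + x $ 1 *\<^sub>R ee 2 - x $ 2 *\<^sub>R ee 4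
         - x $ 4 *\<^sub>R ee 1 - x $ 5 *\<^sub>R ee 7 + x $ 7 *\<^sub>R ee 6 - x $ 6 *\<^sub>R ee 5"

definition para_mult :: "octonion \<Rightarrow> octonion \<Rightarrow> octonion" where
  "para_mult x y = oct_conj x \<odot> oct_conj y"

definition okubo_mult :: "octonion \<Rightarrow> octonion \<Rightarrow> octonion" where
  "okubo_mult x y = tau (oct_conj x) \<odot> tau (tau (oct_conj y))"

lemma UNIV_8: "(UNIV :: 8 set) = {0, 1, 2, 3, 4, 5, 6, 7}"
proof -
  have "card {0, 1, 2, 3, 4, 5, 6, 7 :: 8} = card (UNIV :: 8 set)"
    by simp
  then show ?thesis
    by (metis card_subset_eq finite subset_UNIV)
qed

lemma sum_unit: "(\<Sum>k | P k. ee k) = (\<Sum>k\<in>{0,1,2,3,4,5,6,7}. if P k then ee k else 0)"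
  unfolding UNIV_8[symmetric] by (simp add: sum.If_cases)

lemma unit_mult_0: "unit_mult 0 j = ee j" "unit_mult i 0 = ee i"
  by (simp_all add: unit_mult_def)

lemma unit_mult_table:
  shows "unit_mult 1 1 = - ee 0" "unit_mult 1 2 = ee 4" "unit_mult 1 3 = ee 7" "unit_mult 1 4 = - ee 2" "unit_mult 1 5 = ee 6" "unit_mult 1 6 = - ee 5" "unit_mult 1 7 = - ee 3"
    "unit_mult 2 1 = - ee 4" "unit_mult 2 2 = - ee 0" "unit_mult 2 3 = ee 6" "unit_mult 2 4 = ee 1" "unit_mult 2 5 = - ee 7" "unit_mult 2 6 = - ee 3" "unit_mult 2 7 = ee 5"
    "unit_mult 3 1 = - ee 7" "unit_mult 3 2 = - ee 6" "unit_mult 3 3 = - ee 0" "unit_mult 3 4 = - ee 5" "unit_mult 3 5 = ee 4" "unit_mult 3 6 = ee 2" "unit_mult 3 7 = ee 1"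
    "unit_mult 4 1 = ee 2" "unit_mult 4 2 = - ee 1" "unit_mult 4 3 = ee 5" "unit_mult 4 4 = - ee 0" "unit_mult 4 5 = - ee 3" "unit_mult 4 6 = ee 7" "unit_mult 4 7 = - ee 6"
    "unit_mult 5 1 = - ee 6" "unit_mult 5 2 = ee 7" "unit_mult 5 3 = - ee 4" "unit_mult 5 4 = ee 3" "unit_mult 5 5 = - ee 0" "unit_mult 5 6 = ee 1" "unit_mult 5 7 = - ee 2"
    "unit_mult 6 1 = ee 5" "unit_mult 6 2 = ee 3" "unit_mult 6 3 = - ee 2" "unit_mult 6 4 = - ee 7" "unit_mult 6 5 = - ee 1" "unit_mult 6 6 = - ee 0" "unit_mult 6 7 = ee 4"
    "unit_mult 7 1 = ee 3" "unit_mult 7 2 = - ee 5" "unit_mult 7 3 = - ee 1" "unit_mult 7 4 = ee 6" "unit_mult 7 5 = ee 2" "unit_mult 7 6 = - ee 4" "unit_mult 7 7 = - ee 0"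
  by (simp_all add: unit_mult_def cyclic_triple_def oriented_triples_def sum_unit)

lemma ee_nth: "ee i $ k = (if k = i then 1 else 0)"
  by (simp add: ee_def axis_def)

lemma oct_conj_nth: "oct_conj x $ 0 = x $ 0" "k \<noteq> 0 \<Longrightarrow> oct_conj x $ k = - (x $ k)"
  by (simp_all add: oct_conj_def)

lemma oct_mult_expand: "x \<odot> y =
   (\<Sum>i\<in>{0,1,2,3,4,5,6,7}. \<Sum>j\<in>{0,1,2,3,4,5,6,7}. (x $ i * y $ j) *\<^sub>R unit_mult i j)"
  by (simp only: oct_mult_def UNIV_8)

lemma oct_mult_nth:
  shows "(x \<odot> y) $ 0 =
     x $ 0 * y $ 0 - x $ 1 * y $ 1 - x $ 2 * y $ 2 - x $ 3 * y $ 3 - x $ 4 * y $ 4 - x $ 5 * y $ 5 - x $ 6 * y $ 6 - x $ 7 * y $ 7"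
    and "(x \<odot> y) $ 1 =
     x $ 0 * y $ 1 + x $ 1 * y $ 0 + x $ 2 * y $ 4 + x $ 3 * y $ 7 + x $ 5 * y $ 6 - x $ 4 * y $ 2 - x $ 6 * y $ 5 - x $ 7 * y $ 3"
    and "(x \<odot> y) $ 2 =
     x $ 0 * y $ 2 + x $ 2 * y $ 0 + x $ 3 * y $ 6 + x $ 4 * y $ 1 + x $ 7 * y $ 5 - x $ 1 * y $ 4 - x $ 5 * y $ 7 - x $ 6 * y $ 3"
    and "(x \<odot> y) $ 3 =
     x $ 0 * y $ 3 + x $ 3 * y $ 0 + x $ 5 * y $ 4 + x $ 6 * y $ 2 + x $ 7 * y $ 1 - x $ 1 * y $ 7 - x $ 2 * y $ 6 - x $ 4 * y $ 5"
    and "(x \<odot> y) $ 4 =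
     x $ 0 * y $ 4 + x $ 1 * y $ 2 + x $ 3 * y $ 5 + x $ 4 * y $ 0 + x $ 6 * y $ 7 - x $ 2 * y $ 1 - x $ 5 * y $ 3 - x $ 7 * y $ 6"
    and "(x \<odot> y) $ 5 =
     x $ 0 * y $ 5 + x $ 2 * y $ 7 + x $ 4 * y $ 3 + x $ 5 * y $ 0 + x $ 6 * y $ 1 - x $ 1 * y $ 6 - x $ 3 * y $ 4 - x $ 7 * y $ 2"
    and "(x \<odot> y) $ 6 =
     x $ 0 * y $ 6 + x $ 1 * y $ 5 + x $ 2 * y $ 3 + x $ 6 * y $ 0 + x $ 7 * y $ 4 - x $ 3 * y $ 2 - x $ 4 * y $ 7 - x $ 5 * y $ 1"
    and "(x \<odot> y) $ 7 =
     x $ 0 * y $ 7 + x $ 1 * y $ 3 + x $ 4 * y $ 6 + x $ 5 * y $ 2 + x $ 7 * y $ 0 - x $ 2 * y $ 5 - x $ 3 * y $ 1 - x $ 6 * y $ 4"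
  by (simp_all add: oct_mult_expand unit_mult_0 unit_mult_table ee_nth)

lemma oct_eq_iff: "x = y \<longleftrightarrow> (\<forall>k\<in>{0,1,2,3,4,5,6,7}. x $ k = y $ k)" for x y :: octonion
  unfolding UNIV_8[symmetric] by (simp add: vec_eq_iff)

lemma oct_form_eq: "x \<odot> oct_conj y + y \<odot> oct_conj x = oct_form x y *\<^sub>R ee 0"
  by (simp add: oct_eq_iff oct_form_def oct_mult_nth oct_conj_nth ee_nth)


section \<open>Integral systems\<close>

global_interpretation int_module:
  module "\<lambda>(k::int) (x::'a::real_vector). of_int k *\<^sub>R x"
  by unfold_locales (simp_all add: scaleR_add_right scaleR_add_left)

definition free_of_rank :: "nat \<Rightarrow> 'a::real_vector set \<Rightarrow> bool" where
  "free_of_rank r L \<longleftrightarrow>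
     (\<exists>B. finite B \<and> card B = r \<and> int_module.independent B \<and> int_module.span B = L)"

text \<open>The bilinear form associated with a quadratic form \<open>n\<close>, without a factor 1/2:
  \<open>polar n x x = 2 * n x\<close>.\<close>

definition polar :: "('a::real_vector \<Rightarrow> real) \<Rightarrow> 'a \<Rightarrow> 'a \<Rightarrow> real" where
  "polar n x y = n (x + y) - n x - n y"

definition quadratic_form :: "('a::real_vector \<Rightarrow> real) \<Rightarrow> bool" where
  "quadratic_form n \<longleftrightarrow> (\<forall>c x. n (c *\<^sub>R x) = c\<^sup>2 * n x) \<and> bilinear (polar n)"

definition composition_algebra :: "('a::real_vector \<Rightarrow> 'a \<Rightarrow> 'a) \<Rightarrow> ('a \<Rightarrow> real) \<Rightarrow> bool" where
  "composition_algebra m n \<longleftrightarrow>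
     bilinear m \<and> quadratic_form n \<and>
     (\<forall>x. (\<forall>y. polar n x y = 0) \<longrightarrow> x = 0) \<and>
     (\<forall>x y. n (m x y) = n x * n y)"

definition discrete_euclidean_lattice :: "('a::real_vector \<Rightarrow> 'a \<Rightarrow> real) \<Rightarrow> 'a set \<Rightarrow> bool" where
  "discrete_euclidean_lattice b L \<longleftrightarrow>
     (\<forall>x. x \<noteq> 0 \<longrightarrow> b x x > 0) \<and>
     (\<exists>\<epsilon>>0. \<forall>x\<in>L. \<forall>y\<in>L. x \<noteq> y \<longrightarrow> b (x - y) (x - y) \<ge> \<epsilon>)"

record 'a alg_lattice =
  mult :: "'a \<Rightarrow> 'a \<Rightarrow> 'a"
  qnorm :: "'a \<Rightarrow> real"
  idem :: 'a
  lat :: "'a set"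

definition form :: "'a::real_vector alg_lattice \<Rightarrow> 'a \<Rightarrow> 'a \<Rightarrow> real" where
  "form S = polar (qnorm S)"

definition integral_system :: "'a::real_vector alg_lattice \<Rightarrow> bool" where
  "integral_system S \<longleftrightarrow>
     dim (UNIV :: 'a set) = 8 \<and>
     composition_algebra (mult S) (qnorm S) \<and>
     idem S \<noteq> 0 \<and> mult S (idem S) (idem S) = idem S \<and>
     free_of_rank 8 (lat S) \<and>
     idem S \<in> lat S \<and> (\<forall>x\<in>lat S. \<forall>y\<in>lat S. mult S x y \<in> lat S) \<and>
     (\<forall>x\<in>lat S. qnorm S x \<in> \<int> \<and> form S x (idem S) \<in> \<int>) \<and>
     discrete_euclidean_lattice (form S) (lat S)"

definition roots :: "'a alg_lattice \<Rightarrow> 'a set" where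
  "roots S = {x \<in> lat S. qnorm S x = 1}"

definition lattice_isometry ::
    "'a::real_vector alg_lattice \<Rightarrow> 'b::real_vector alg_lattice \<Rightarrow> ('a \<Rightarrow> 'b) \<Rightarrow> bool" where
  "lattice_isometry S T f \<longleftrightarrow>
     bij_betw f (lat S) (lat T) \<and>
     (\<forall>x\<in>lat S. \<forall>y\<in>lat S. f (x + y) = f x + f y) \<and>
     (\<forall>x\<in>lat S. qnorm T (f x) = qnorm S x)"

text \<open>Isomorphism of the (not necessarily unital or associative) \<open>\<int>\<close>-algebras on the lattices; no
  compatibility with norms or idempotents is required.\<close>

definition algebra_isomorphic ::
    "'a::real_vector alg_lattice \<Rightarrow> 'b::real_vector alg_lattice \<Rightarrow> bool" where
  "algebra_isomorphic S T \<longleftrightarrow>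
     (\<exists>f. bij_betw f (lat S) (lat T) \<and>
        (\<forall>x\<in>lat S. \<forall>y\<in>lat S. f (x + y) = f x + f y) \<and>
        (\<forall>x\<in>lat S. \<forall>y\<in>lat S. f (mult S x y) = mult T (f x) (f y)))"

definition gram :: "('a \<Rightarrow> 'a \<Rightarrow> real) \<Rightarrow> (8 \<Rightarrow> 'a) \<Rightarrow> real ^ 8 ^ 8" where
  "gram b v = (\<chi> i j. b (v i) (v j))"


section \<open>The root system \<open>E\<^sub>8\<close> and the Gosset polytope\<close>

definition E8_roots :: "(real ^ 8) set" where
  "E8_roots =
     {axis i s + axis j t | i j s t. i \<noteq> j \<and> s \<in> {-1, 1} \<and> t \<in> {-1, 1}} \<union>
     {x. (\<forall>i. x $ i \<in> {-1/2, 1/2}) \<and> even (card {i. x $ i < 0})}"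

definition E8_root_system :: "('a::real_vector \<Rightarrow> 'a \<Rightarrow> real) \<Rightarrow> 'a set \<Rightarrow> bool" where
  "E8_root_system b R \<longleftrightarrow>
     (\<exists>f :: 'a \<Rightarrow> real ^ 8. linear f \<and> bij f \<and> (\<forall>x y. f x \<bullet> f y = b x y) \<and> f ` R = E8_roots)"

definition gosset_polytope :: "('a::real_vector \<Rightarrow> 'a \<Rightarrow> real) \<Rightarrow> 'a set \<Rightarrow> bool" where
  "gosset_polytope b P \<longleftrightarrow> (\<exists>R. E8_root_system b R \<and> P = convex hull R)"


section \<open>The Coxeter--Dickson order and its three products\<close>

definition hh :: octonion where
  "hh = (1/2) *\<^sub>R (ee 1 + ee 2 + ee 3 + ee 4)"

definition LE_basis :: "8 \<Rightarrow> octonion" where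
  "LE_basis = (\<lambda>_. 0)(0 := ee 0, 1 := ee 1, 2 := ee 2, 3 := ee 3,
     4 := hh, 5 := ee 1 \<odot> hh, 6 := ee 2 \<odot> hh, 7 := ee 3 \<odot> hh)"

definition LE :: "octonion set" where
  "LE = int_module.span (range LE_basis)"

definition LE_oct :: "octonion alg_lattice" where
  "LE_oct = \<lparr>mult = (\<odot>), qnorm = oct_norm, idem = ee 0, lat = LE\<rparr>"

definition LE_para :: "octonion alg_lattice" where
  "LE_para = \<lparr>mult = para_mult, qnorm = oct_norm, idem = ee 0, lat = LE\<rparr>"

definition LE_okubo :: "octonion alg_lattice" where
  "LE_okubo = \<lparr>mult = okubo_mult, qnorm = oct_norm, idem = ee 0, lat = LE\<rparr>"

end

theory Submission
  imports Defs
begin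

text \<open>The three products have the same norm and the same lattice, so all metric claims reduce to one
  lattice. With respect to \<open>oct_form\<close> it is unimodular, hence membership in \<open>LE\<close> is integrality of the
  pairings with the basis; this gives closure under conjugation, \<open>tau\<close> and the product by a check on
  basis vectors. A similarity of ratio \<open>\<surd>2\<close> maps \<open>LE\<close> onto the standard \<open>E\<^sub>8\<close> lattice, whose
  vectors of squared length 2 are the roots. Since the roots lie on a sphere, each is an extreme point
  of their convex hull. The products are told apart by two invariants: only the octonionic one has a
  left unit, and the para-octonionic one has a nonzero element commuting with everything, while the
  Okubo product has none.\<close>

section \<open>Coordinates, norm and polar form of the octonions; the three bilinear
  products\<close>

lemma sum_8:
  "(\<Sum>k\<in>(UNIV::8 set). g k) = g 0 + g 1 + g 2 + g 3 + g 4 + g 5 + g 6 + (g 7 :: 'a::comm_monoid_add)"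
  unfolding UNIV_8 by (simp add: add.assoc)

lemma all_8: "(\<forall>k::8. P k) \<longleftrightarrow> P 0 \<and> P 1 \<and> P 2 \<and> P 3 \<and> P 4 \<and> P 5 \<and> P 6 \<and> P 7"
proof -
  have "(\<forall>k. P k) \<longleftrightarrow> (\<forall>k\<in>UNIV. P k)"
    by (simp only: ball_UNIV)
  then show ?thesis
    unfolding UNIV_8 by (simp only: ball_simps simp_thms)
qed

lemma oct_norm_eq_inner: "oct_norm x = x \<bullet> x"
  by (simp add: oct_norm_def inner_vec_def power2_eq_square)

lemma oct_form_eq_inner: "oct_form x y = 2 * (x \<bullet> y)"
  by (simp add: oct_form_def oct_mult_nth oct_conj_nth inner_vec_def sum_8 algebra_simps)

lemma polar_oct_norm: "polar oct_norm = oct_form"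
  by (intro ext) (simp add: polar_def oct_norm_eq_inner oct_form_eq_inner inner_add_left inner_add_right
      inner_commute)

lemma bilinear_oct_form: "bilinear oct_form"
  unfolding bilinear_def oct_form_eq_inner
  by (auto intro!: linearI simp: inner_add_left inner_add_right algebra_simps)

text \<open>Degen's eight-square identity, verified as a polynomial identity in the sixteen
  coordinates.\<close>

lemma oct_norm_mult: "oct_norm (x \<odot> y) = oct_norm x * oct_norm y"
  unfolding oct_norm_def sum_8 oct_mult_nth by algebra

lemma bilinear_oct_mult: "bilinear (\<odot>)"
  unfolding bilinear_def
  by (auto intro!: linearI simp: oct_mult_def sum.distrib algebra_simps scaleR_sum_right)

lemma linear_oct_conj: "linear oct_conj"
  by (intro linearI) (simp_all add: oct_conj_def vec_eq_iff)

lemma linear_tau: "linear tau"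
  by (intro linearI) (simp_all add: tau_def algebra_simps)

text \<open>The automorphism is a signed permutation of the coordinates, here read backwards:
  \<open>tau\<close> sends \<open>ee 4\<close> to \<open>- ee 1\<close>, so coordinate 1 of
  \<open>tau x\<close> is \<open>- x $ 4\<close>.\<close>

lemma tau_nth:
  "tau x $ 0 = x $ 0" "tau x $ 1 = - x $ 4" "tau x $ 2 = x $ 1" "tau x $ 3 = x $ 3"
  "tau x $ 4 = - x $ 2" "tau x $ 5 = - x $ 6" "tau x $ 6 = x $ 7" "tau x $ 7 = - x $ 5"
  by (simp_all add: tau_def ee_nth)

lemma oct_norm_conj: "oct_norm (oct_conj x) = oct_norm x"
  by (simp add: oct_norm_def sum_8 oct_conj_nth)

lemma oct_norm_tau: "oct_norm (tau x) = oct_norm x"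
  by (simp add: oct_norm_def sum_8 tau_nth)

lemma bilinear_compose2:
  assumes "bilinear m" "linear f" "linear g"
  shows "bilinear (\<lambda>x y. m (f x) (g y))"
  using assms linear_compose[unfolded o_def, of f] linear_compose[unfolded o_def, of g]
  unfolding bilinear_def by blast

lemma bilinear_para_mult: "bilinear para_mult"
  using bilinear_compose2[OF bilinear_oct_mult linear_oct_conj linear_oct_conj]
  by (simp only: para_mult_def[abs_def])

lemma bilinear_okubo_mult: "bilinear okubo_mult"
  using bilinear_compose2[OF bilinear_oct_mult linear_compose[OF linear_oct_conj linear_tau]
      linear_compose[OF linear_compose[OF linear_oct_conj linear_tau] linear_tau]]
  by (simp only: okubo_mult_def[abs_def] o_def)

text \<open>Leaves only what depends on the product to be shown; nondegeneracy holds because the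
  polar form is twice the inner product.\<close>

lemma composition_algebra_oct_norm:
  assumes "bilinear m" "\<And>x y. oct_norm (m x y) = oct_norm x * oct_norm y"
  shows "composition_algebra m oct_norm"
  using assms bilinear_oct_form
  unfolding composition_algebra_def quadratic_form_def polar_oct_norm
  by (auto simp: oct_form_eq_inner oct_norm_eq_inner power2_eq_square)

section \<open>The lattice \<open>LE\<close>: coordinates of its basis, induction, freeness and
  self-duality\<close>

lemma LE_basis_nth:
  shows "LE_basis 0 $ 0 = 1" "LE_basis 0 $ 1 = 0" "LE_basis 0 $ 2 = 0" "LE_basis 0 $ 3 = 0"
    "LE_basis 0 $ 4 = 0" "LE_basis 0 $ 5 = 0" "LE_basis 0 $ 6 = 0" "LE_basis 0 $ 7 = 0"
    "LE_basis 1 $ 0 = 0" "LE_basis 1 $ 1 = 1" "LE_basis 1 $ 2 = 0" "LE_basis 1 $ 3 = 0"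
    "LE_basis 1 $ 4 = 0" "LE_basis 1 $ 5 = 0" "LE_basis 1 $ 6 = 0" "LE_basis 1 $ 7 = 0"
    "LE_basis 2 $ 0 = 0" "LE_basis 2 $ 1 = 0" "LE_basis 2 $ 2 = 1" "LE_basis 2 $ 3 = 0"
    "LE_basis 2 $ 4 = 0" "LE_basis 2 $ 5 = 0" "LE_basis 2 $ 6 = 0" "LE_basis 2 $ 7 = 0"
    "LE_basis 3 $ 0 = 0" "LE_basis 3 $ 1 = 0" "LE_basis 3 $ 2 = 0" "LE_basis 3 $ 3 = 1"
    "LE_basis 3 $ 4 = 0" "LE_basis 3 $ 5 = 0" "LE_basis 3 $ 6 = 0" "LE_basis 3 $ 7 = 0"
    "LE_basis 4 $ 0 = 0" "LE_basis 4 $ 1 = 1/2" "LE_basis 4 $ 2 = 1/2" "LE_basis 4 $ 3 = 1/2"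
    "LE_basis 4 $ 4 = 1/2" "LE_basis 4 $ 5 = 0" "LE_basis 4 $ 6 = 0" "LE_basis 4 $ 7 = 0"
    "LE_basis 5 $ 0 = -1/2" "LE_basis 5 $ 1 = 0" "LE_basis 5 $ 2 = -1/2" "LE_basis 5 $ 3 = 0"
    "LE_basis 5 $ 4 = 1/2" "LE_basis 5 $ 5 = 0" "LE_basis 5 $ 6 = 0" "LE_basis 5 $ 7 = 1/2"
    "LE_basis 6 $ 0 = -1/2" "LE_basis 6 $ 1 = 1/2" "LE_basis 6 $ 2 = 0" "LE_basis 6 $ 3 = 0"
    "LE_basis 6 $ 4 = -1/2" "LE_basis 6 $ 5 = 0" "LE_basis 6 $ 6 = 1/2" "LE_basis 6 $ 7 = 0"
    "LE_basis 7 $ 0 = -1/2" "LE_basis 7 $ 1 = 0" "LE_basis 7 $ 2 = 0" "LE_basis 7 $ 3 = 0"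
    "LE_basis 7 $ 4 = 0" "LE_basis 7 $ 5 = -1/2" "LE_basis 7 $ 6 = -1/2" "LE_basis 7 $ 7 = -1/2"
  by (simp_all add: LE_basis_def hh_def oct_mult_nth ee_nth)

lemma LE_basis_in_LE: "LE_basis i \<in> LE"
  unfolding LE_def by (rule int_module.span_base) simp

lemma LE_add: "x \<in> LE \<Longrightarrow> y \<in> LE \<Longrightarrow> x + y \<in> LE"
  unfolding LE_def by (rule int_module.span_add)

lemma LE_diff: "x \<in> LE \<Longrightarrow> y \<in> LE \<Longrightarrow> x - y \<in> LE"
  unfolding LE_def by (rule int_module.span_diff)

lemma LE_scale: "x \<in> LE \<Longrightarrow> of_int k *\<^sub>R x \<in> LE"
  unfolding LE_def by (rule int_module.span_scale)

lemma zero_in_LE: "0 \<in> LE"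
  unfolding LE_def by (rule int_module.span_zero)

lemma LE_induct [consumes 1, case_names zero basis add scale]:
  assumes "x \<in> LE" "P 0" "\<And>i. P (LE_basis i)" "\<And>x y. P x \<Longrightarrow> P y \<Longrightarrow> P (x + y)"
    "\<And>k x. P x \<Longrightarrow> P (of_int k *\<^sub>R x)"
  shows "P x"
proof -
  have "int_module.span (range LE_basis) \<subseteq> Collect P"
    using assms by (intro int_module.span_minimal int_module.subspaceI) auto
  then show ?thesis
    using assms(1) by (auto simp: LE_def)
qed

lemma LE_sum: "(\<Sum>i\<in>UNIV. of_int (c i) *\<^sub>R LE_basis i) \<in> LE"
  unfolding LE_def by (intro int_module.span_sum int_module.span_scale int_module.span_base) simp

text \<open>Independence over the reals, which includes independence over the integers: the eight
  coordinate equations form a regular linear system in the coefficients.\<close>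

lemma LE_basis_eq_zeroD:
  assumes "(\<Sum>i\<in>UNIV. c i *\<^sub>R LE_basis i) = 0"
  shows "c i = 0"
proof -
  have "\<forall>i. c i = 0"
    using assms unfolding oct_eq_iff all_8 by (simp add: sum_8 LE_basis_nth)
  then show ?thesis ..
qed

text \<open>Lets independence of the indexed family pass to the set \<open>range LE_basis\<close>,
  which then has eight elements.\<close>

lemma inj_LE_basis: "inj LE_basis"
proof (rule injI)
  fix i j assume eq: "LE_basis i = LE_basis j"
  show "i = j"
  proof (rule ccontr)
    assume "i \<noteq> j"
    \<comment> \<open>Equal vectors at distinct indices would give a nontrivial vanishing
      combination, with coefficient 1 at \<open>i\<close> and -1 at \<open>j\<close>.\<close>
    moreover have "(\<Sum>k\<in>UNIV. (of_bool (k = i) - of_bool (k = j)) *\<^sub>R LE_basis k) = 0"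
      using eq
      by (simp add: scaleR_diff_left sum_subtractf of_bool_def if_distrib[of "\<lambda>c. c *\<^sub>R _"]
          cong: if_cong)
    ultimately show False
      using LE_basis_eq_zeroD[of "\<lambda>k. of_bool (k = i) - of_bool (k = j)" i] by simp
  qed
qed

lemma free_of_rank_LE: "free_of_rank 8 LE"
proof -
  have "u v = 0"
    if t: "finite t" "t \<subseteq> range LE_basis" "(\<Sum>v\<in>t. of_int (u v) *\<^sub>R v) = 0" "v \<in> t"
    for t v and u :: "octonion \<Rightarrow> int"
  proof -
    obtain i where i: "v = LE_basis i"
      using t by blast
    \<comment> \<open>The coefficients on the subset \<open>t\<close> are extended by zero to the
      whole basis and reindexed.\<close>
    define c where "c = (\<lambda>i. if LE_basis i \<in> t then real_of_int (u (LE_basis i)) else 0)"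
    have "(\<Sum>v\<in>t. of_int (u v) *\<^sub>R v) =
        (\<Sum>v\<in>range LE_basis. (if v \<in> t then of_int (u v) else 0) *\<^sub>R v)"
      using t by (intro sum.mono_neutral_cong_left) auto
    also have "\<dots> = (\<Sum>i\<in>UNIV. c i *\<^sub>R LE_basis i)"
      using inj_LE_basis by (simp add: sum.reindex c_def)
    finally have "c i = 0"
      using t by (intro LE_basis_eq_zeroD) simp
    then show ?thesis
      using i t by (simp add: c_def)
  qed
  then show ?thesis
    unfolding free_of_rank_def LE_def
    by (intro exI[of _ "range LE_basis"])
      (auto simp: card_image inj_LE_basis int_module.independent_explicit_module)
qed

text \<open>The coefficients of \<open>x\<close> are given by the inverse of the Gram matrix, which is integral because
  the lattice is unimodular.\<close>

lemma LE_if_oct_form_Ints: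
  assumes "\<And>i. oct_form x (LE_basis i) \<in> \<int>"
  shows "x \<in> LE"
proof -
  have "\<forall>i. \<exists>k. oct_form x (LE_basis i) = of_int k"
    using assms by (auto elim!: Ints_cases)
  then obtain g where g: "\<And>i. oct_form x (LE_basis i) = of_int (g i)"
    by metis
  define c where "c = ((\<lambda>_ :: 8. 0 :: int)
     (0 := 6*g 0 - 2*g 1 + 2*g 2 + 4*g 5 + 4*g 6 + 3*g 7,
      1 := -2*g 0 + 4*g 1 + 2*g 2 + 2*g 3 - 4*g 4 - 3*g 6 - g 7,
      2 := 2*g 0 + 2*g 1 + 4*g 2 + 2*g 3 - 4*g 4 + 3*g 5 + g 7,
      3 := 2*g 1 + 2*g 2 + 2*g 3 - 3*g 4 + g 5 - g 6,
      4 := -4*g 1 - 4*g 2 - 3*g 3 + 6*g 4 - 2*g 5 + 2*g 6,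
      5 := 4*g 0 + 3*g 2 + g 3 - 2*g 4 + 4*g 5 + 2*g 6 + 2*g 7,
      6 := 4*g 0 - 3*g 1 - g 3 + 2*g 4 + 2*g 5 + 4*g 6 + 2*g 7,
      7 := 3*g 0 - g 1 + g 2 + 2*g 5 + 2*g 6 + 2*g 7))"
  have "x = (\<Sum>i\<in>UNIV. of_int (c i) *\<^sub>R LE_basis i)"
    unfolding oct_eq_iff
    by (simp add: sum_8 c_def LE_basis_nth flip: g)
       (simp add: oct_form_eq_inner inner_vec_def sum_8 LE_basis_nth field_simps)
  also have "\<dots> \<in> LE"
    by (rule LE_sum)
  finally show ?thesis .
qed

section \<open>Integrality of form and norm, and closure of \<open>LE\<close> under the maps
  involved\<close>

lemma linear_oct_form: "linear (oct_form x)" "linear (\<lambda>x. oct_form x y)"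
  using bilinear_oct_form by (simp_all add: bilinear_def)

lemma gram_LE_basis_Ints: "oct_form (LE_basis i) (LE_basis j) \<in> \<int>"
proof -
  have "\<forall>i j. oct_form (LE_basis i) (LE_basis j) \<in> \<int>"
    unfolding all_8 by (simp add: oct_form_eq_inner inner_vec_def sum_8 LE_basis_nth)
  then show ?thesis
    by blast
qed

text \<open>The integers are closed under sums and integer multiples, so integrality spreads from
  the basis to its span. This serves one argument of the form at a time, and later the functionals
  that describe the \<open>E8_lattice\<close>.\<close>

lemma Ints_linear_LE:
  fixes f :: "octonion \<Rightarrow> real"
  assumes "linear f" "\<And>i. f (LE_basis i) \<in> \<int>" "x \<in> LE"
  shows "f x \<in> \<int>"
  using assms(3)
proof (induction rule: LE_induct)
  case (basis i)
  show ?case by (rule assms(2))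
qed (simp_all add: linear_0[OF assms(1)] linear_add[OF assms(1)] linear_cmul[OF assms(1)])

lemma oct_form_Ints: "x \<in> LE \<Longrightarrow> y \<in> LE \<Longrightarrow> oct_form x y \<in> \<int>"
  by (rule Ints_linear_LE[OF linear_oct_form(1)], rule Ints_linear_LE[OF linear_oct_form(2)],
      rule gram_LE_basis_Ints)

lemma linear_LE_closed:
  assumes "linear f" "\<And>i. f (LE_basis i) \<in> LE" "x \<in> LE"
  shows "f x \<in> LE"
  using assms(3)
proof (induction rule: LE_induct)
  case (basis i)
  show ?case by (rule assms(2))
qed (simp_all add: linear_0[OF assms(1)] linear_add[OF assms(1)] linear_cmul[OF assms(1)]
    zero_in_LE LE_add LE_scale)

lemma oct_norm_add: "oct_norm (x + y) = oct_norm x + oct_norm y + oct_form x y"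
  by (simp flip: polar_oct_norm add: polar_def)

lemma oct_norm_Ints:
  assumes "x \<in> LE"
  shows "oct_norm x \<in> \<int>"
proof -
  \<comment> \<open>The norm is quadratic: the sum step has the cross term
    \<open>oct_form x y\<close>, whose integrality requires both summands in \<open>LE\<close>.
    Hence membership is carried through the induction.\<close>
  have "x \<in> LE \<and> oct_norm x \<in> \<int>"
    using assms
  proof (induction rule: LE_induct)
    case (basis i)
    have "\<forall>i. oct_norm (LE_basis i) \<in> \<int>"
      unfolding all_8 by (simp add: oct_norm_def sum_8 LE_basis_nth power2_eq_square)
    then show ?case
      by (simp add: LE_basis_in_LE)
  next
    case (add x y)
    then show ?case
      by (simp add: oct_norm_add LE_add oct_form_Ints)
  next
    case (scale k x)
    then show ?case
      by (simp add: oct_norm_eq_inner LE_scale)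
  qed (simp add: zero_in_LE oct_norm_def)
  then show ?thesis ..
qed

text \<open>By self-duality the images of the basis vectors lie in \<open>LE\<close> once their 64
  pairings with the basis are integers; no expansion in the basis has to be found.\<close>

lemma oct_conj_LE: "x \<in> LE \<Longrightarrow> oct_conj x \<in> LE"
proof (rule linear_LE_closed[OF linear_oct_conj])
  fix i
  have "\<forall>i j. oct_form (oct_conj (LE_basis i)) (LE_basis j) \<in> \<int>"
    unfolding all_8
    by (simp add: oct_form_eq_inner inner_vec_def sum_8 LE_basis_nth oct_conj_nth)
  then show "oct_conj (LE_basis i) \<in> LE"
    by (blast intro: LE_if_oct_form_Ints)
qed

lemma tau_LE: "x \<in> LE \<Longrightarrow> tau x \<in> LE"
proof (rule linear_LE_closed[OF linear_tau])
  fix i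
  have "\<forall>i j. oct_form (tau (LE_basis i)) (LE_basis j) \<in> \<int>"
    unfolding all_8
    by (simp add: oct_form_eq_inner inner_vec_def sum_8 LE_basis_nth tau_nth)
  then show "tau (LE_basis i) \<in> LE"
    by (blast intro: LE_if_oct_form_Ints)
qed

text \<open>Linearity in each factor in turn reduces the claim to products of basis vectors, that
  is, to 512 integral pairings.\<close>

lemma oct_mult_LE: "x \<in> LE \<Longrightarrow> y \<in> LE \<Longrightarrow> x \<odot> y \<in> LE"
proof (rule linear_LE_closed[of "\<lambda>y. x \<odot> y"])
  show "linear (\<lambda>y. x \<odot> y)"
    using bilinear_oct_mult by (simp add: bilinear_def)
next
  fix j assume "x \<in> LE"
  then show "x \<odot> LE_basis j \<in> LE"
  proof (rule linear_LE_closed[of "\<lambda>x. x \<odot> LE_basis j", rotated 2])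
    show "linear (\<lambda>x. x \<odot> LE_basis j)"
      using bilinear_oct_mult by (simp add: bilinear_def)
  next
    fix i
    have "\<forall>i j k. oct_form (LE_basis i \<odot> LE_basis j) (LE_basis k) \<in> \<int>"
      unfolding all_8
      by (simp add: oct_form_eq_inner inner_vec_def sum_8 oct_mult_nth LE_basis_nth)
    then show "LE_basis i \<odot> LE_basis j \<in> LE"
      by (blast intro: LE_if_oct_form_Ints)
  qed
qed

lemma ee_LE: "ee 0 \<in> LE" "ee 1 \<in> LE" "ee 2 \<in> LE" "ee 3 \<in> LE"
  using LE_basis_in_LE[of 0] LE_basis_in_LE[of 1] LE_basis_in_LE[of 2] LE_basis_in_LE[of 3]
  by (simp_all add: LE_basis_def)

section \<open>The three integral systems\<close>

lemma integral_system_LE: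
  assumes "bilinear m" "\<And>x y. oct_norm (m x y) = oct_norm x * oct_norm y"
    "\<And>x y. x \<in> LE \<Longrightarrow> y \<in> LE \<Longrightarrow> m x y \<in> LE" "m (ee 0) (ee 0) = ee 0"
  shows "integral_system \<lparr>mult = m, qnorm = oct_norm, idem = ee 0, lat = LE\<rparr>"
proof -
  \<comment> \<open>The difference of distinct lattice vectors has a positive integral form value,
    so 1 serves as separation constant.\<close>
  have discrete: "oct_form (x - y) (x - y) \<ge> 1" if "x \<in> LE" "y \<in> LE" "x \<noteq> y" for x y
  proof -
    have "oct_form (x - y) (x - y) > 0"
      using that by (simp add: oct_form_eq_inner)
    then show ?thesis
      using Ints_nonzero_abs_ge1[OF oct_form_Ints[OF LE_diff LE_diff, of x y x y]] that by simp
  qed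
  have "discrete_euclidean_lattice oct_form LE"
    unfolding discrete_euclidean_lattice_def
    using discrete by (auto simp: oct_form_eq_inner intro!: exI[of _ 1])
  moreover have "ee 0 \<noteq> 0"
    by (metis ee_nth zero_index zero_neq_one)
  ultimately show ?thesis
    using assms ee_LE(1) composition_algebra_oct_norm[of m] free_of_rank_LE oct_form_Ints oct_norm_Ints
    by (simp add: integral_system_def form_def polar_oct_norm)
qed

lemma tau_ee_0: "tau (ee 0) = ee 0" and oct_conj_ee_0: "oct_conj (ee 0) = ee 0"
  by (simp_all add: oct_eq_iff tau_nth oct_conj_nth ee_nth)

lemma oct_mult_ee_0: "ee 0 \<odot> x = x" "x \<odot> ee 0 = x"
  by (simp_all add: oct_eq_iff oct_mult_nth ee_nth)

lemma integral_systems: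
  "integral_system LE_oct" "integral_system LE_para" "integral_system LE_okubo"
  unfolding LE_oct_def LE_para_def LE_okubo_def
  by (intro integral_system_LE bilinear_oct_mult bilinear_para_mult bilinear_okubo_mult;
      simp add: oct_norm_mult para_mult_def okubo_mult_def oct_norm_conj oct_norm_tau oct_mult_LE
        oct_conj_LE tau_LE oct_mult_ee_0 tau_ee_0 oct_conj_ee_0)+

section \<open>Algebra invariants that separate the three products\<close>

definition left_unital :: "'a alg_lattice \<Rightarrow> bool" where
  "left_unital S \<longleftrightarrow> (\<exists>u\<in>lat S. \<forall>x\<in>lat S. mult S u x = x)"

text \<open>Central means commuting with the lattice only, with no associativity condition.\<close>

definition has_central :: "'a::zero alg_lattice \<Rightarrow> bool" where
  "has_central S \<longleftrightarrow> (\<exists>z\<in>lat S. z \<noteq> 0 \<and> (\<forall>x\<in>lat S. mult S z x = mult S x z))"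

lemma left_unital_isomorphic:
  assumes "algebra_isomorphic S T" "left_unital S"
  shows "left_unital T"
proof -
  obtain f where f: "bij_betw f (lat S) (lat T)"
      "\<And>x y. x \<in> lat S \<Longrightarrow> y \<in> lat S \<Longrightarrow> f (mult S x y) = mult T (f x) (f y)"
    using assms(1) by (auto simp: algebra_isomorphic_def)
  have lat: "lat T = f ` lat S"
    using f(1) by (simp add: bij_betw_def)
  obtain u where u: "u \<in> lat S" "\<And>x. x \<in> lat S \<Longrightarrow> mult S u x = x"
    using assms(2) by (auto simp: left_unital_def)
  have "mult T (f u) (f x) = f x" if "x \<in> lat S" for x
    using f(2)[OF u(1) that] u(2)[OF that] by simp
  then show ?thesis
    using u(1) by (auto simp: left_unital_def lat)
qed

lemma has_central_isomorphic:
  assumes "algebra_isomorphic S T" "0 \<in> lat S" "has_central S"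
  shows "has_central T"
proof -
  obtain f where f: "bij_betw f (lat S) (lat T)"
      "\<And>x y. x \<in> lat S \<Longrightarrow> y \<in> lat S \<Longrightarrow> f (x + y) = f x + f y"
      "\<And>x y. x \<in> lat S \<Longrightarrow> y \<in> lat S \<Longrightarrow> f (mult S x y) = mult T (f x) (f y)"
    using assms(1) by (auto simp: algebra_isomorphic_def)
  have lat: "lat T = f ` lat S" and inj: "inj_on f (lat S)"
    using f(1) by (simp_all add: bij_betw_def)
  obtain z where z: "z \<in> lat S" "z \<noteq> 0" "\<And>x. x \<in> lat S \<Longrightarrow> mult S z x = mult S x z"
    using assms(3) by (auto simp: has_central_def)
  \<comment> \<open>Additivity at \<open>0 + 0\<close> gives this, and injectivity then keeps the
    image of \<open>z\<close> nonzero.\<close>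
  have "f 0 = 0"
    using f(2)[OF assms(2) assms(2)] by simp
  then have "f z \<noteq> 0"
    using inj_onD[OF inj _ z(1) assms(2)] z(2) by auto
  moreover have "mult T (f z) (f x) = mult T (f x) (f z)" if "x \<in> lat S" for x
    using f(3)[OF z(1) that] f(3)[OF that z(1)] z(3)[OF that] by simp
  ultimately show ?thesis
    using z(1) by (auto simp: has_central_def lat)
qed

lemma left_unital_LE_oct: "left_unital LE_oct"
  using ee_LE(1)
  by (auto simp: left_unital_def LE_oct_def oct_mult_ee_0 intro!: bexI[of _ "ee 0"])

text \<open>Acting as the identity on \<open>ee 0\<close> forces \<open>u = ee 0\<close> for both
  products. But then \<open>ee 1\<close> is sent to \<open>- ee 1\<close> by the para-octonionic
  product and to \<open>ee 4\<close> by the Okubo product.\<close>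

lemma not_left_unital:
  "\<not> left_unital LE_para" "\<not> left_unital LE_okubo"
proof -
  show "\<not> left_unital LE_para"
  proof
    assume "left_unital LE_para"
    then obtain u where u: "\<And>x. x \<in> LE \<Longrightarrow> para_mult u x = x"
      by (auto simp: left_unital_def LE_para_def)
    show False
      using u[OF ee_LE(1)] u[OF ee_LE(2)]
      by (simp add: oct_eq_iff para_mult_def oct_mult_nth oct_conj_nth ee_nth)
  qed
  show "\<not> left_unital LE_okubo"
  proof
    assume "left_unital LE_okubo"
    then obtain u where u: "\<And>x. x \<in> LE \<Longrightarrow> okubo_mult u x = x"
      by (auto simp: left_unital_def LE_okubo_def)
    show False
      using u[OF ee_LE(1)] u[OF ee_LE(2)]
      by (simp add: oct_eq_iff okubo_mult_def oct_mult_nth oct_conj_nth tau_nth ee_nth)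
  qed
qed

text \<open>Para-multiplication by \<open>ee 0\<close> is conjugation on either side.\<close>

lemma has_central_LE_para: "has_central LE_para"
  using ee_LE(1)
  by (auto simp: has_central_def LE_para_def para_mult_def oct_conj_ee_0 oct_mult_ee_0 oct_eq_iff
      ee_nth intro!: bexI[of _ "ee 0"])

lemma not_has_central_LE_okubo: "\<not> has_central LE_okubo"
proof
  assume "has_central LE_okubo"
  then obtain z where z: "z \<noteq> 0" "\<And>x. x \<in> LE \<Longrightarrow> okubo_mult z x = okubo_mult x z"
    by (auto simp: has_central_def LE_okubo_def)
  \<comment> \<open>These are linear equations in the coordinates of \<open>z\<close>. Testing
    against \<open>ee 0\<close> makes \<open>tau\<close> fix \<open>oct_conj z\<close>, testing
    against \<open>ee 3\<close> then leaves only the span of \<open>ee 0\<close> and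
    \<open>ee 3\<close>, and the others leave only zero.\<close>
  have eqs: "\<forall>k. okubo_mult z (ee 0) $ k = okubo_mult (ee 0) z $ k"
    "\<forall>k. okubo_mult z (ee 1) $ k = okubo_mult (ee 1) z $ k"
    "\<forall>k. okubo_mult z (ee 2) $ k = okubo_mult (ee 2) z $ k"
    "\<forall>k. okubo_mult z (ee 3) $ k = okubo_mult (ee 3) z $ k"
    using z(2) ee_LE by simp_all
  have conj: "oct_conj x $ k = (if k = 0 then x $ k else - x $ k)" for x k
    by (simp add: oct_conj_def)
  note coords = okubo_mult_def all_8 oct_mult_nth tau_nth conj ee_nth
  have "\<forall>k. z $ k = 0"
    unfolding all_8 using eqs[simplified coords, simplified]
    by (intro conjI; linarith)
  then show False
    using z(1) by (simp add: vec_eq_iff)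
qed

section \<open>The standard \<open>E8\<close> lattice and its vectors of squared length 2\<close>

text \<open>The lattice D8 together with its translate by the all-halves vector. The common offset
  \<open>a\<close> treats both cosets alike.\<close>

definition E8_lattice :: "(real ^ 8) set" where
  "E8_lattice = {y. (\<exists>a\<in>{0, 1/2}. \<forall>i. y $ i - a \<in> \<int>) \<and> (\<Sum>i\<in>UNIV. y $ i) / 2 \<in> \<int>}"

lemma E8_lattice_inner_Ints:
  assumes "y \<in> E8_lattice" "w \<in> E8_lattice"
  shows "y \<bullet> w \<in> \<int>"
proof -
  obtain a where a: "a \<in> {0, 1/2}" "\<And>i. y $ i - a \<in> \<int>" and y: "(\<Sum>i\<in>UNIV. y $ i) / 2 \<in> \<int>"
    using assms(1) by (auto simp only: E8_lattice_def)
  obtain b where b: "b \<in> {0, 1/2}" "\<And>i. w $ i - b \<in> \<int>" and w: "(\<Sum>i\<in>UNIV. w $ i) / 2 \<in> \<int>"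
    using assms(2) by (auto simp only: E8_lattice_def)
  \<comment> \<open>Expanded around the offsets. Both coordinate sums are even and the offsets are 0
    or 1/2, so each of the four terms is an integer.\<close>
  have "y \<bullet> w = (\<Sum>i\<in>UNIV. (y $ i - a) * (w $ i - b)) + b * (\<Sum>i\<in>UNIV. y $ i)
      + a * (\<Sum>i\<in>UNIV. w $ i) - 8 * (a * b)"
    by (simp add: inner_vec_def sum_8 algebra_simps)
  also have "\<dots> \<in> \<int>"
  proof (intro Ints_add Ints_diff Ints_sum Ints_mult[OF a(2) b(2)])
    show "b * (\<Sum>i\<in>UNIV. y $ i) \<in> \<int>"
      using b(1) y by (auto simp del: eq_divide_eq_numeral1)
    show "a * (\<Sum>i\<in>UNIV. w $ i) \<in> \<int>"
      using a(1) w by (auto simp del: eq_divide_eq_numeral1)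
    show "8 * (a * b) \<in> \<int>"
      using a(1) b(1) by (auto simp del: eq_divide_eq_numeral1)
  qed
  finally show ?thesis .
qed

text \<open>Replaces the existential offset by integrality of functionals linear in
  \<open>y\<close>, a condition that can be checked on a basis.\<close>

lemma E8_latticeI:
  assumes "2 * y $ 0 \<in> \<int>" "\<And>i. y $ i - y $ 0 \<in> \<int>" "(\<Sum>i\<in>UNIV. y $ i) / 2 \<in> \<int>"
  shows "y \<in> E8_lattice"
proof -
  obtain k where k: "2 * y $ 0 = of_int k"
    using assms(1) by (rule Ints_cases)
  \<comment> \<open>The fractional part of \<open>y $ 0\<close>, read off from the parity of
    \<open>2 * y $ 0\<close>.\<close>
  define a :: real where "a = of_int (k mod 2) / 2"
  have "real_of_int k = of_int (k div 2 * 2 + k mod 2)"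
    by (simp only: div_mult_mod_eq)
  then have "y $ 0 = of_int (k div 2) + a"
    using k unfolding a_def of_int_add of_int_mult of_int_numeral by linarith
  then have "y $ i - a \<in> \<int>" for i
    using Ints_add[OF assms(2)[of i], of "of_int (k div 2)"] by (simp add: algebra_simps)
  moreover have "a \<in> {0, 1/2}"
    by (auto simp: a_def)
  ultimately show ?thesis
    using assms(3) unfolding E8_lattice_def by blast
qed

text \<open>Eight entries 1/2 sum to 4, and each sign change lowers the sum by 1. This links the
  parity condition in \<open>E8_roots\<close> to the sum condition in
  \<open>E8_lattice\<close>.\<close>

lemma sum_half_signs:
  fixes x :: "real ^ 8"
  assumes "\<forall>i. x $ i \<in> {-1/2, 1/2}"
  shows "(\<Sum>i\<in>UNIV. x $ i) = 4 - real (card {i. x $ i < 0})"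
proof -
  have "x $ i = 1/2 - of_bool (x $ i < 0)" for i
    using assms by (cases "x $ i < 0") force+
  then have "(\<Sum>i\<in>UNIV. x $ i) = (\<Sum>i\<in>UNIV. 1/2 - of_bool (x $ i < 0))"
    by (rule sum.cong[OF refl])
  also have "\<dots> = 4 - real (card {i. x $ i < 0})"
    by (simp add: sum_subtractf)
  finally show ?thesis .
qed

lemma even_iff_half_Ints: "even n \<longleftrightarrow> real n / 2 \<in> \<int>"
proof
  assume "real n / 2 \<in> \<int>"
  then obtain k where "real n / 2 = of_int k"
    by (rule Ints_cases)
  then have "int n = 2 * k"
    by linarith
  then show "even n"
    by presburger
qed auto

text \<open>A nonzero integer with square at most 2 is a sign. Removing one such entry leaves the
  sum 1, which forces a second one; removing that leaves 0.\<close>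

lemma sum_squares_eq_2:
  fixes z :: "'a::finite \<Rightarrow> int"
  assumes "(\<Sum>i\<in>UNIV. (z i)\<^sup>2) = 2"
  obtains i j where "i \<noteq> j" "z i \<in> {-1, 1}" "z j \<in> {-1, 1}" "\<And>k. k \<noteq> i \<Longrightarrow> k \<noteq> j \<Longrightarrow> z k = 0"
proof -
  have unit: "a \<in> {-1, 1}" if "a\<^sup>2 \<le> 2" "a \<noteq> 0" for a :: int
  proof -
    have "\<bar>a\<bar>\<^sup>2 < 2\<^sup>2"
      using that(1) by simp
    then have "\<bar>a\<bar> < 2"
      by (rule power2_less_imp_less) simp
    then show ?thesis
      using that(2) by auto
  qed
  obtain i where i: "z i \<noteq> 0"
  proof -
    have "\<exists>i. z i \<noteq> 0"
    proof (rule ccontr)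
      assume "\<nexists>i. z i \<noteq> 0"
      then show False
        using assms by simp
    qed
    then show ?thesis
      using that by blast
  qed
  have split_i: "(\<Sum>k\<in>UNIV. (z k)\<^sup>2) = (z i)\<^sup>2 + (\<Sum>k\<in>UNIV - {i}. (z k)\<^sup>2)"
    by (simp add: sum.remove)
  have nonneg: "(\<Sum>k\<in>A. (z k)\<^sup>2) \<ge> 0" for A
    by (simp add: sum_nonneg)
  have zi: "z i \<in> {-1, 1}"
    using i assms split_i nonneg[of "UNIV - {i}"] by (intro unit) linarith+
  then have rest: "(\<Sum>k\<in>UNIV - {i}. (z k)\<^sup>2) = 1"
    using assms split_i by auto
  obtain j where j: "j \<noteq> i" "z j \<noteq> 0"
  proof -
    have "\<exists>j\<in>UNIV - {i}. z j \<noteq> 0"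
    proof (rule ccontr)
      assume "\<not> ?thesis"
      then have "(\<Sum>k\<in>UNIV - {i}. (z k)\<^sup>2) = 0"
        by (intro sum.neutral) auto
      then show False
        using rest by simp
    qed
    then show ?thesis
      using that by blast
  qed
  have split_j: "(\<Sum>k\<in>UNIV - {i}. (z k)\<^sup>2) = (z j)\<^sup>2 + (\<Sum>k\<in>UNIV - {i} - {j}. (z k)\<^sup>2)"
    using j by (intro sum.remove) auto
  have zj: "z j \<in> {-1, 1}"
    using j rest split_j nonneg[of "UNIV - {i} - {j}"] by (intro unit) linarith+
  then have "(\<Sum>k\<in>UNIV - {i} - {j}. (z k)\<^sup>2) = 0"
    using rest split_j by auto
  then have "\<And>k. k \<noteq> i \<Longrightarrow> k \<noteq> j \<Longrightarrow> z k = 0"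
    by (simp add: sum_nonneg_eq_0_iff)
  then show ?thesis
    using that j(1) zi zj by metis
qed

lemma E8_roots_subset: "E8_roots \<subseteq> {y \<in> E8_lattice. y \<bullet> y = 2}"
proof
  fix y :: "real ^ 8" assume "y \<in> E8_roots"
  then consider i j s t where "y = axis i s + axis j t" "i \<noteq> j" "s \<in> {-1, 1}" "t \<in> {-1, 1}"
    | "\<forall>i. y $ i \<in> {-1/2, 1/2}" "even (card {i. y $ i < 0})"
    unfolding E8_roots_def by blast
  then show "y \<in> {y \<in> E8_lattice. y \<bullet> y = 2}"
  proof cases
    case 1
    have "(\<Sum>k\<in>UNIV. y $ k) = s + t"
      by (simp add: 1(1) sum.distrib axis_def)
    moreover have "\<forall>k. y $ k \<in> \<int>"
      using 1 by (auto simp: axis_def)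
    moreover have "y \<bullet> y = s\<^sup>2 + t\<^sup>2"
      using 1(2) by (simp add: 1(1) inner_add_left inner_add_right inner_axis_axis power2_eq_square)
    ultimately show ?thesis
      using 1(3,4) by (auto simp: E8_lattice_def)
  next
    case 2
    have "\<forall>k. y $ k - 1/2 \<in> \<int>"
    proof
      fix k
      consider "y $ k = -1/2" | "y $ k = 1/2"
        using 2(1) by blast
      then show "y $ k - 1/2 \<in> \<int>"
        by cases (simp_all del: eq_divide_eq_numeral1)
    qed
    moreover have "(\<Sum>i\<in>UNIV. y $ i) / 2 \<in> \<int>"
      using 2 unfolding sum_half_signs[OF 2(1)] by (simp add: diff_divide_distrib flip: even_iff_half_Ints)
    moreover have "y \<bullet> y = (\<Sum>i\<in>(UNIV::8 set). 1/4)"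
      unfolding inner_vec_def
    proof (rule sum.cong[OF refl])
      fix k
      consider "y $ k = -1/2" | "y $ k = 1/2"
        using 2(1) by blast
      then show "y $ k \<bullet> y $ k = 1/4"
        by cases (simp_all del: eq_divide_eq_numeral1)
    qed
    ultimately show ?thesis
      by (auto simp: E8_lattice_def)
  qed
qed

lemma E8_roots_eq: "E8_roots = {y \<in> E8_lattice. y \<bullet> y = 2}"
proof (intro equalityI E8_roots_subset subsetI)
  fix y assume "y \<in> {y \<in> E8_lattice. y \<bullet> y = 2}"
  then have sum: "(\<Sum>i\<in>UNIV. y $ i) / 2 \<in> \<int>" and sq: "(\<Sum>i\<in>UNIV. (y $ i)\<^sup>2) = 2"
    and "(\<forall>i. y $ i \<in> \<int>) \<or> (\<forall>i. y $ i - 1/2 \<in> \<int>)"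
    by (auto simp: E8_lattice_def inner_vec_def power2_eq_square)
  then consider "\<forall>i. y $ i \<in> \<int>" | "\<forall>i. y $ i - 1/2 \<in> \<int>"
    by blast
  then show "y \<in> E8_roots"
  proof cases
    case 1
    then have "\<forall>i. \<exists>k. y $ i = of_int k"
      by (auto elim!: Ints_cases)
    then obtain z where z: "\<And>i. y $ i = of_int (z i)"
      by metis
    have "of_int (\<Sum>i\<in>UNIV. (z i)\<^sup>2) = (of_int 2 :: real)"
      using sq by (simp add: z)
    then have "(\<Sum>i\<in>UNIV. (z i)\<^sup>2) = 2"
      by (simp only: of_int_eq_iff)
    then obtain i j where ij: "i \<noteq> j" "z i \<in> {-1, 1}" "z j \<in> {-1, 1}"
      "\<And>k. k \<noteq> i \<Longrightarrow> k \<noteq> j \<Longrightarrow> z k = 0"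
      using sum_squares_eq_2 by metis
    have "y = axis i (of_int (z i)) + axis j (of_int (z j))"
      using ij by (auto simp: vec_eq_iff axis_def z)
    moreover have "real_of_int (z i) \<in> {-1, 1}" "real_of_int (z j) \<in> {-1, 1}"
      using ij by auto
    ultimately show ?thesis
      using ij(1) unfolding E8_roots_def by blast
  next
    case 2
    \<comment> \<open>With \<open>y $ i = k + 1/2\<close> the difference is
      \<open>k * (k + 1)\<close>, a product of consecutive integers. The eight differences sum to
      \<open>2 - 8/4 = 0\<close>, so each vanishes.\<close>
    have ge: "(y $ i)\<^sup>2 - 1/4 \<ge> 0" for i
    proof -
      obtain k where "y $ i - 1/2 = of_int k"
        using 2 by (blast elim: Ints_cases)
      then have "(y $ i)\<^sup>2 - 1/4 = of_int (k * (k + 1))"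
        by (simp add: algebra_simps power2_eq_square)
      moreover have "k * (k + 1) \<ge> 0"
        by (cases "k \<ge> 0") (auto intro: mult_nonpos_nonpos)
      ultimately show ?thesis
        by (simp only: of_int_0_le_iff)
    qed
    have "(\<Sum>i\<in>UNIV. (y $ i)\<^sup>2 - 1/4) = 0"
      using sq by (simp add: sum_subtractf)
    then have "(y $ i)\<^sup>2 = (1/2)\<^sup>2" for i
      using ge by (subst (asm) sum_nonneg_eq_0_iff) (auto simp: power2_eq_square)
    then have half: "\<forall>i. y $ i \<in> {-1/2, 1/2}"
      by (simp only: power2_eq_iff) auto
    \<comment> \<open>This number is half the count of negative entries.\<close>
    have "(2::real) - (\<Sum>i\<in>UNIV. y $ i) / 2 \<in> \<int>"
      using sum by simp
    then have "even (card {i. y $ i < 0})"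
      unfolding even_iff_half_Ints sum_half_signs[OF half] by (simp add: diff_divide_distrib)
    then show ?thesis
      using half by (simp add: E8_roots_def)
  qed
qed

section \<open>The similarity from \<open>LE\<close> onto the standard \<open>E8\<close>
  lattice\<close>

text \<open>\<open>\<surd>2\<close> times an orthogonal map. The minimal sets of half-integral coordinates of elements of
  \<open>LE\<close> are the planes of an affine space \<open>AG(3,2)\<close>, and the coordinates are paired along its lines in
  one direction, so that each plane consists of whole pairs or meets every pair once.\<close>

definition E8_coords :: "octonion \<Rightarrow> real ^ 8" where
  "E8_coords x = (\<chi> i. ((\<lambda>_. 0)(0 := x $ 0 + x $ 6, 1 := x $ 0 - x $ 6, 2 := x $ 1 + x $ 4,
     3 := x $ 1 - x $ 4, 4 := x $ 2 + x $ 3, 5 := x $ 2 - x $ 3, 6 := x $ 5 + x $ 7,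
     7 := x $ 5 - x $ 7)) i)"

lemma E8_coords_nth:
  "E8_coords x $ 0 = x $ 0 + x $ 6" "E8_coords x $ 1 = x $ 0 - x $ 6"
  "E8_coords x $ 2 = x $ 1 + x $ 4" "E8_coords x $ 3 = x $ 1 - x $ 4"
  "E8_coords x $ 4 = x $ 2 + x $ 3" "E8_coords x $ 5 = x $ 2 - x $ 3"
  "E8_coords x $ 6 = x $ 5 + x $ 7" "E8_coords x $ 7 = x $ 5 - x $ 7"
  by (simp_all add: E8_coords_def)

lemma E8_coords_inner: "E8_coords x \<bullet> E8_coords y = oct_form x y"
  by (simp add: oct_form_eq_inner inner_vec_def sum_8 E8_coords_nth algebra_simps)

lemma linear_E8_coords: "linear E8_coords"
  by (intro linearI) (simp_all add: vec_eq_iff all_8 E8_coords_nth algebra_simps)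

text \<open>Injective because the positive definite form is carried to the inner product; surjective
  since both dimensions are eight.\<close>

lemma bij_E8_coords: "bij E8_coords"
proof -
  have "inj E8_coords"
  proof (rule linear_injective_0[THEN iffD2, OF linear_E8_coords], intro allI impI)
    fix x assume "E8_coords x = 0"
    then have "oct_form x x = 0"
      by (simp flip: E8_coords_inner)
    then show "x = 0"
      by (simp add: oct_form_eq_inner)
  qed
  then show ?thesis
    using linear_injective_imp_surjective[OF linear_E8_coords] by (simp add: bij_def)
qed

lemma E8_coords_LE:
  assumes "x \<in> LE"
  shows "E8_coords x \<in> E8_lattice"
proof (rule E8_latticeI)
  have coord: "linear (\<lambda>x. E8_coords x $ i)" for i
    using linear_compose[OF linear_E8_coords bounded_linear.linear[OF bounded_linear_vec_nth]]
    by (simp add: o_def)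
  show "2 * E8_coords x $ 0 \<in> \<int>"
  proof (rule Ints_linear_LE[OF _ _ assms])
    show "linear (\<lambda>x. 2 * E8_coords x $ 0)"
      using linear_compose_scale_right[OF coord, of 2 0] by simp
    have "\<forall>i. 2 * E8_coords (LE_basis i) $ 0 \<in> \<int>"
      unfolding all_8 by (simp add: E8_coords_nth LE_basis_nth)
    then show "2 * E8_coords (LE_basis i) $ 0 \<in> \<int>" for i
      by blast
  qed
  show "E8_coords x $ k - E8_coords x $ 0 \<in> \<int>" for k
  proof (rule Ints_linear_LE[OF _ _ assms])
    show "linear (\<lambda>x. E8_coords x $ k - E8_coords x $ 0)"
      by (intro linear_compose_sub coord)
    have "\<forall>i k. E8_coords (LE_basis i) $ k - E8_coords (LE_basis i) $ 0 \<in> \<int>"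
      unfolding all_8 by (simp add: E8_coords_nth LE_basis_nth)
    then show "E8_coords (LE_basis i) $ k - E8_coords (LE_basis i) $ 0 \<in> \<int>" for i
      by blast
  qed
  show "(\<Sum>k\<in>UNIV. E8_coords x $ k) / 2 \<in> \<int>"
  proof (rule Ints_linear_LE[OF _ _ assms])
    show "linear (\<lambda>x. (\<Sum>k\<in>UNIV. E8_coords x $ k) / 2)"
      using linear_compose_scale_right[OF linear_compose_sum[of UNIV "\<lambda>k x. E8_coords x $ k"], of "1/2"] coord
      by simp
    have "\<forall>i. (\<Sum>k\<in>UNIV. E8_coords (LE_basis i) $ k) / 2 \<in> \<int>"
      unfolding all_8 by (simp add: sum_8 E8_coords_nth LE_basis_nth)
    then show "(\<Sum>k\<in>UNIV. E8_coords (LE_basis i) $ k) / 2 \<in> \<int>" for i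
      by blast
  qed
qed

text \<open>For the converse, an \<open>x\<close> with image in the \<open>E8_lattice\<close> pairs
  integrally with the basis of \<open>LE\<close>, so it lies in the dual lattice, which is
  \<open>LE\<close> itself.\<close>

lemma E8_coords_in_lattice_iff: "E8_coords x \<in> E8_lattice \<longleftrightarrow> x \<in> LE"
proof
  assume x: "E8_coords x \<in> E8_lattice"
  have "oct_form x (LE_basis i) \<in> \<int>" for i
    unfolding E8_coords_inner[symmetric]
    by (rule E8_lattice_inner_Ints[OF x E8_coords_LE[OF LE_basis_in_LE]])
  then show "x \<in> LE"
    by (rule LE_if_oct_form_Ints)
qed (rule E8_coords_LE)

text \<open>Norm 1 corresponds to squared length 2, as \<open>oct_form x x\<close> is twice the
  norm.\<close>

lemma E8_coords_roots: "E8_coords ` {x \<in> LE. oct_norm x = 1} = E8_roots"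
proof -
  have "x \<in> LE \<and> oct_norm x = 1 \<longleftrightarrow> E8_coords x \<in> E8_roots" for x
    by (simp add: E8_roots_eq E8_coords_in_lattice_iff E8_coords_inner oct_form_eq_inner oct_norm_eq_inner)
  then show ?thesis
    using bij_E8_coords by (auto simp: bij_def image_iff)
qed

lemma E8_root_system_LE: "E8_root_system oct_form {x \<in> LE. oct_norm x = 1}"
  unfolding E8_root_system_def
  using linear_E8_coords bij_E8_coords E8_coords_inner E8_coords_roots by blast

section \<open>Extreme points of the convex hull of points on a sphere\<close>

lemma extreme_points_hull_sphere:
  fixes R :: "'a::euclidean_space set"
  assumes "\<And>x. x \<in> R \<Longrightarrow> norm x = r"
  shows "{x. x extreme_point_of (convex hull R)} = R"
proof (intro equalityI extreme_points_of_convex_hull subsetI CollectI)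
  fix x assume x: "x \<in> R"
  have ball: "convex hull R \<subseteq> cball 0 r"
    using assms by (intro hull_minimal) auto
  show "x extreme_point_of (convex hull R)"
    unfolding extreme_point_of_def
  proof (intro conjI ballI notI)
    show "x \<in> convex hull R"
      using x by (rule hull_inc)
    fix a b assume ab: "a \<in> convex hull R" "b \<in> convex hull R" "x \<in> open_segment a b"
    \<comment> \<open>A point inside a segment is strictly closer to the centre than one of the
      endpoints, yet both endpoints lie in the ball on whose boundary \<open>x\<close> lies.\<close>
    have "dist 0 x < dist 0 a \<or> dist 0 x < dist 0 b"
      using dist_decreases_open_segment[OF ab(3)] by blast
    then show False
      using assms[OF x] ball ab(1,2) by (auto simp: subset_iff)
  qed
qed

section \<open>Counting the 240 roots\<close>

text \<open>A vector whose nonzero entries share one absolute value is encoded by its support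
  \<open>A\<close> and its negative positions \<open>N\<close>, so that counting roots becomes
  counting sets.\<close>

definition signed_indicator :: "'n::finite set \<Rightarrow> 'n set \<Rightarrow> real \<Rightarrow> real ^ 'n" where
  "signed_indicator A N c = (\<chi> i. if i \<in> N then - c else if i \<in> A then c else 0)"

text \<open>Recovers the encoding from the vector, which gives injectivity in the counts.\<close>

lemma signed_indicator_sets:
  assumes "N \<subseteq> A" "c > 0"
  shows "{i. signed_indicator A N c $ i \<noteq> 0} = A" "{i. signed_indicator A N c $ i < 0} = N"
  using assms by (auto simp: signed_indicator_def)

text \<open>The support is an unordered pair, which removes the double counting in the description
  by \<open>i\<close>, \<open>j\<close>, \<open>s\<close>, \<open>t\<close>.\<close>

lemma E8_roots_integral:
  "{axis i s + axis j t | i j s t. i \<noteq> j \<and> s \<in> {-1, 1} \<and> t \<in> {-1, 1}} =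
     (\<lambda>(A, N). signed_indicator A N 1) ` (SIGMA A:{A. card A = 2}. Pow A)" (is "?L = ?R")
proof (intro equalityI subsetI)
  fix x assume "x \<in> ?L"
  then obtain i j s t where x: "x = axis i s + axis j t" "i \<noteq> j" "s \<in> {-1, 1}" "t \<in> {-1, 1}"
    by blast
  have "x = signed_indicator {i, j} ({k. k = i \<and> s = -1} \<union> {k. k = j \<and> t = -1}) 1"
    using x by (auto simp: vec_eq_iff signed_indicator_def axis_def)
  moreover have "card {i, j} = 2"
    using x(2) by simp
  ultimately show "x \<in> ?R"
    by (intro image_eqI[where x = "({i, j}, {k. k = i \<and> s = -1} \<union> {k. k = j \<and> t = -1})"]) auto
next
  fix x assume "x \<in> ?R"
  then obtain A N where x: "x = signed_indicator A N 1" "card A = 2" "N \<subseteq> A"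
    by auto
  obtain i j where ij: "A = {i, j}" "i \<noteq> j"
    using x(2) by (auto simp: card_2_iff)
  have "x = axis i (if i \<in> N then -1 else 1) + axis j (if j \<in> N then -1 else 1)"
    using x(1,3) ij by (auto simp: vec_eq_iff signed_indicator_def axis_def)
  then show "x \<in> ?L"
    using ij(2) by fastforce
qed

lemma E8_roots_half:
  "{x :: real ^ 'n. (\<forall>i. x $ i \<in> {-1/2, 1/2}) \<and> even (card {i. x $ i < 0})} =
     (\<lambda>N. signed_indicator UNIV N (1/2)) ` {N. even (card N)}" (is "?L = ?R")
proof (intro equalityI subsetI)
  fix x assume x: "x \<in> ?L"
  then have "x $ i = (if x $ i < 0 then -1/2 else 1/2)" for i
    by (cases "x $ i < 0") force+
  then have "\<forall>i. x $ i = (if i \<in> {i. x $ i < 0} then - (1/2) else if i \<in> UNIV then 1/2 else 0)"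
    by (metis UNIV_I mem_Collect_eq minus_divide_left)
  then have "x = signed_indicator UNIV {i. x $ i < 0} (1/2)"
    unfolding vec_eq_iff signed_indicator_def vec_lambda_beta .
  then show "x \<in> ?R"
    using x by blast
next
  fix x assume "x \<in> ?R"
  then obtain N where N: "x = signed_indicator UNIV N (1/2)" "even (card N)"
    by blast
  then have "{i. x $ i < 0} = N"
    by (simp add: signed_indicator_sets)
  then show "x \<in> ?L"
    using N by (simp add: signed_indicator_def)
qed

lemma card_E8_roots: "card E8_roots = 240"
proof -
  define D where "D = (\<lambda>(A, N). signed_indicator A N 1) ` (SIGMA A:{A :: 8 set. card A = 2}. Pow A)"
  define H where "H = (\<lambda>N. signed_indicator (UNIV :: 8 set) N (1/2)) ` {N. even (card N)}"
  have subsets: "card {A :: 8 set. card A = k} = 8 choose k" for k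
    using n_subsets[of "UNIV :: 8 set" k] by simp
  have "inj_on (\<lambda>(A, N). signed_indicator A N 1) (SIGMA A:{A :: 8 set. card A = 2}. Pow A)"
    by (rule inj_on_inverseI[of _ "\<lambda>x. ({i. x $ i \<noteq> 0}, {i. x $ i < 0})"])
      (clarsimp simp only: signed_indicator_sets Pow_iff zero_less_one prod.case simp_thms)
  then have "card D = (\<Sum>A | card (A :: 8 set) = 2. card (Pow A))"
    unfolding D_def by (simp add: card_image card_SigmaI)
  \<comment> \<open>There are 28 supports with four sign patterns each.\<close>
  also have "\<dots> = (\<Sum>A | card (A :: 8 set) = 2. 4)"
    by (intro sum.cong) (auto simp: card_Pow)
  also have "\<dots> = 112"
    by (simp add: subsets choose_two)
  finally have D: "card D = 112" .
  have "inj_on (\<lambda>N. signed_indicator (UNIV :: 8 set) N (1/2)) {N. even (card N)}"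
    by (rule inj_on_inverseI[of _ "\<lambda>x. {i. x $ i < 0}"]) (simp add: signed_indicator_sets)
  then have "card H = card {N :: 8 set. even (card N)}"
    unfolding H_def by (rule card_image)
  also have "{N :: 8 set. even (card N)} = (\<Union>k\<in>{0, 2, 4, 6, 8}. {N. card N = k})"
  proof -
    have "card N \<le> 8" for N :: "8 set"
      using card_mono[of UNIV N] by simp
    moreover have "even n \<longleftrightarrow> n \<in> {0, 2, 4, 6, 8}" if "n \<le> 8" for n :: nat
      using that by auto
    ultimately show ?thesis
      by blast
  qed
  also have "card \<dots> = (\<Sum>k\<in>{0, 2, 4, 6, 8}. card {N :: 8 set. card N = k})"
    by (rule card_UN_disjoint) auto
  \<comment> \<open>The even binomial coefficients 1 + 28 + 70 + 28 + 1.\<close>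
  also have "\<dots> = 128"
    by (simp add: subsets) (simp add: numeral_eq_Suc)
  finally have H: "card H = 128" .
  have "finite D" "finite H"
    unfolding D_def H_def by simp_all
  \<comment> \<open>Entries are integers in one family and proper halves in the other.\<close>
  moreover have "D \<inter> H = {}"
  proof -
    have "x $ i \<in> {-1, 0, 1}" if "x \<in> D" for x i
      using that by (auto simp: D_def signed_indicator_def split: if_splits)
    moreover have "x $ i \<notin> {-1, 0, 1}" if "x \<in> H" for x i
      using that by (auto simp: H_def signed_indicator_def split: if_splits)
    ultimately show ?thesis
      by blast
  qed
  ultimately have "card (D \<union> H) = 240"
    using D H by (simp add: card_Un_disjoint)
  then show ?thesis
    by (simp only: E8_roots_def E8_roots_integral E8_roots_half D_def H_def)
qed

section \<open>Transfer to the three systems and conclusion\<close>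

text \<open>The three records differ only in \<open>mult\<close>, so every metric claim becomes one
  about \<open>LE\<close> and \<open>oct_norm\<close>.\<close>

lemma form_LE:
  assumes "S \<in> {LE_oct, LE_para, LE_okubo}"
  shows "lat S = LE" "qnorm S = oct_norm" "form S = oct_form"
    "roots S = {x \<in> LE. oct_norm x = 1}"
  using assms
  by (auto simp: LE_oct_def LE_para_def LE_okubo_def roots_def form_def polar_oct_norm)

lemma card_roots_LE: "card {x \<in> LE. oct_norm x = 1} = 240"
  using card_image[OF inj_on_subset[OF bij_is_inj[OF bij_E8_coords] subset_UNIV], of "{x \<in> LE. oct_norm x = 1}"]
  by (simp add: E8_coords_roots card_E8_roots)

lemma extreme_points_roots_LE:
  "{v. v extreme_point_of (convex hull {x \<in> LE. oct_norm x = 1})} = {x \<in> LE. oct_norm x = 1}"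
  by (rule extreme_points_hull_sphere[of _ 1]) (simp add: oct_norm_eq_inner norm_eq_1)

lemma non_isomorphic_LE:
  "\<not> algebra_isomorphic LE_oct LE_para" "\<not> algebra_isomorphic LE_oct LE_okubo"
  "\<not> algebra_isomorphic LE_para LE_okubo"
proof -
  have "0 \<in> lat LE_para"
    by (simp add: LE_para_def zero_in_LE)
  then show "\<not> algebra_isomorphic LE_para LE_okubo"
    using has_central_isomorphic has_central_LE_para not_has_central_LE_okubo by blast
qed (use left_unital_isomorphic left_unital_LE_oct not_left_unital in blast)+

theorem proposition9:
  "(\<forall>S \<in> {LE_oct, LE_para, LE_okubo}. integral_system S) \<and>
   (\<forall>S \<in> {LE_oct, LE_para, LE_okubo}. \<forall>T \<in> {LE_oct, LE_para, LE_okubo}.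
      lattice_isometry S T (\<lambda>x. x) \<and>
      gram (form S) LE_basis = gram (form T) LE_basis \<and>
      roots S = roots T \<and>
      convex hull (roots S) = convex hull (roots T)) \<and>
   (\<forall>S \<in> {LE_oct, LE_para, LE_okubo}.
      gram (form S) LE_basis = gram oct_form LE_basis \<and>
      card (roots S) = 240 \<and>
      E8_root_system (form S) (roots S) \<and>
      gosset_polytope (form S) (convex hull (roots S)) \<and>
      {v. v extreme_point_of (convex hull (roots S))} = roots S) \<and>
   \<not> algebra_isomorphic LE_oct LE_para \<and>
   \<not> algebra_isomorphic LE_oct LE_okubo \<and>
   \<not> algebra_isomorphic LE_para LE_okubo"
proof (intro conjI ballI)
  fix S assume "S \<in> {LE_oct, LE_para, LE_okubo}"
  note S = form_LE[OF this]
  show "gram (form S) LE_basis = gram oct_form LE_basis"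
    and "card (roots S) = 240"
    and "{v. v extreme_point_of (convex hull (roots S))} = roots S"
    by (simp_all only: S card_roots_LE extreme_points_roots_LE)
  show "E8_root_system (form S) (roots S)"
    unfolding S by (rule E8_root_system_LE)
  then show "gosset_polytope (form S) (convex hull (roots S))"
    unfolding gosset_polytope_def by blast
  fix T assume "T \<in> {LE_oct, LE_para, LE_okubo}"
  note T = form_LE[OF this]
  show "gram (form S) LE_basis = gram (form T) LE_basis" "roots S = roots T"
      "convex hull (roots S) = convex hull (roots T)"
    by (simp_all only: S T)
  show "lattice_isometry S T (\<lambda>x. x)"
    by (simp add: lattice_isometry_def S T bij_betw_def)
qed (use integral_systems non_isomorphic_LE in auto)

end
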